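(* Let $n\ge4$. Partition $V(\mathcal{Q}(n))=V_1\cup V_2$, where $V_1=\{(r,c)\mid c\le r\}$ is the set of the $\frac{n(n+1)}{2}$ squares of the right triangle having the main diagonal as hypotenuse (the blue vertices), and $V_2=\{(r,c)\mid c>r\}$ is the set of the remaining $\frac{(n-1)n}{2}$ squares (the red vertices). Then there are edge subsets $E_1,E_2\subseteq E(\mathcal{Q}(n))$, with the edges of $E_k$ having both ends in $V_k$, such that the following hold. (1) The graphs $G_1=(V_1,E_1)$ and $G_2=(V_2,E_2)$ satisfy $G_1\cong\mathcal{T}(n)$ and $G_2\cong\mathcal{T}(n-1)$; so the graph $G_{1,2}=G_1+G_2$ (disjoint union, with vertex set $V(\mathcal{Q}(n))$) has two components, isomorphic to $\mathcal{T}(n)$ and $\mathcal{T}(n-1)$. (2) Let $G_3$ be the graph with $V(G_3)=V(\mathcal{Q}(n))$ and $E(G_3)=E(\mathcal{Q}(n))\setminus E(G_{1,2})$. Then $A(G_3)=A(G_3^1)+A(G_3^2)$, where $G_3^1$ and $G_3^2$ are graphs with vertex set $V(\mathcal{Q}(n))$ such that: (a) the connected components of $G_3^1$ are the cliques formed by the edges of the diagonals parallel to the second diagonal of the board (the sets of squares $(r,c)$ with $r+c$ constant), that is, $K_1,K_2,\dots,K_{n-1},K_n,K_{n-1},\dots,K_2,K_1$; (b) the edges of $G_3^2$, $E(G_3^2)=E(G_3)\setminus E(G_3^1)$, are partitioned into the horizontal edges (between squares of the same row) joining blue and red vertices and the vertical edges (between squares of the same column) joining blue and red vertices, which define graphs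 $G_{3,H}^2$ and $G_{3,V}^2$ respectively, with vertex set $V(\mathcal{Q}(n))$, such that $A(G_3^2)=A(G_{3,H}^2)+A(G_{3,V}^2)$. For each $X\in\{H,V\}$ the components of $G_{3,X}^2$ are the complete bipartite graphs $K_{1,n-1},K_{2,n-2},\dots,K_{n-1,1}$ together with $K_{n,0}$, i.e. $n$ isolated vertices. Consequently $$A(\mathcal{Q}(n))=A(G_{1,2})+A(G_3)=A(G_{1,2})+\Big(A(G_3^1)+\big(A(G_{3,H}^2)+A(G_{3,V}^2)\big)\Big).$$
   Context: The $n$-Queens' graph $\mathcal{Q}(n)$ is the simple graph whose vertices are the $n^2$ squares $(r,c)$, $1\le r,c\le n$ ($r$ the row counted from the top, $c$ the column counted from the left), of the $n\times n$ chessboard, two distinct squares being adjacent if and only if they lie in the same row, in the same column, or on a common diagonal (of either direction). The main diagonal is $\{(r,r)\}$ and the second diagonal is $\{(r,c)\mid r+c=n+1\}$. For a positive integer $m$, the triangular graph $\mathcal{T}(m)$ is the simple graph with vertex set $\{(i,j)\mid i\in\{1,\dots,m\},\ j\in\{1,\dots,i\}\}$, in which two distinct vertices $(i,j)$ and $(k,\ell)$ are adjacent if and only if $i=k$ or $j=\ell$ or $i-j=k-\ell$. $A(G)$ is the adjacency matrix of $G$; all graphs on the vertex set $V(\mathcal{Q}(n))$ use the same ordering of the vertices. $K_m$ is the complete graph on $m$ vertices and $K_{p,q}$ the complete bipartite graph; $K_{n,0}$ denotes $n$ isolated vertices. *)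

theory Defs
  imports
    Complex_Main
    "Graph_Theory.Kuratowski"
    "Graph_Theory.Digraph_Isomorphism"
    "Jordan_Normal_Form.Matrix"
begin

text \<open>
  Simple graphs are the symmetric, loop-free finite digraphs \<^const>\<open>pair_graph\<close> of
  the Graph_Theory library: an undirected edge uv is the pair of arcs (u,v), (v,u), and an edge
  set is a symmetric set of arcs. For such graphs the strongly connected components
  \<^const>\<open>pre_digraph.sccs\<close> (maximal strongly connected induced subgraphs) are the
  connected components.
\<close>

definition board :: "nat \<Rightarrow> (nat \<times> nat) set" where
  "board n = {1..n} \<times> {1..n}"

definition queens :: "nat \<Rightarrow> (nat \<times> nat) pair_pre_digraph" where
  "queens n = \<lparr> pverts = board n,
     parcs = {((r, c), (r', c')). (r, c) \<in> board n \<and> (r', c') \<in> board n \<and> (r, c) \<noteq> (r', c') \<and>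
       (r = r' \<or> c = c' \<or> int r - int c = int r' - int c' \<or> r + c = r' + c')} \<rparr>"

definition triangle_verts :: "nat \<Rightarrow> (nat \<times> nat) set" where
  "triangle_verts m = {(i, j). i \<in> {1..m} \<and> j \<in> {1..i}}"

definition triangular :: "nat \<Rightarrow> (nat \<times> nat) pair_pre_digraph" where
  "triangular m = \<lparr> pverts = triangle_verts m,
     parcs = {((i, j), (k, l)). (i, j) \<in> triangle_verts m \<and> (k, l) \<in> triangle_verts m \<and>
       (i, j) \<noteq> (k, l) \<and> (i = k \<or> j = l \<or> int i - int j = int k - int l)} \<rparr>"

definition blue :: "nat \<Rightarrow> (nat \<times> nat) set" where
  "blue n = {(r, c) \<in> board n. c \<le> r}"

definition red :: "nat \<Rightarrow> (nat \<times> nat) set" where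
  "red n = {(r, c) \<in> board n. c > r}"

definition joins :: "'a set \<Rightarrow> 'a set \<Rightarrow> 'a \<times> 'a \<Rightarrow> bool" where
  "joins A B e \<longleftrightarrow> e \<in> A \<times> B \<or> e \<in> B \<times> A"

definition horizontal :: "(nat \<times> nat) \<times> (nat \<times> nat) \<Rightarrow> bool" where
  "horizontal e \<longleftrightarrow> fst (fst e) = fst (snd e)"

definition vertical :: "(nat \<times> nat) \<times> (nat \<times> nat) \<Rightarrow> bool" where
  "vertical e \<longleftrightarrow> snd (fst e) = snd (snd e)"

definition antidiagonal :: "nat \<Rightarrow> nat \<Rightarrow> (nat \<times> nat) set" where
  "antidiagonal n s = {(r, c) \<in> board n. r + c = s}"

definition clique_on :: "'a set \<Rightarrow> 'a pair_pre_digraph" where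
  "clique_on S = \<lparr> pverts = S, parcs = {(u, v). u \<in> S \<and> v \<in> S \<and> u \<noteq> v} \<rparr>"

abbreviation components :: "'a pair_pre_digraph \<Rightarrow> ('a, 'a \<times> 'a) pre_digraph set" where
  "components G \<equiv> pre_digraph.sccs (with_proj G)"

text \<open>
  The components of G, each counted once and taken in a suitable order, satisfy the
  predicates in the list one by one. In particular G has exactly as many components as the
  list has entries, so repeated entries such as K_1, K_1 are counted with multiplicity.
\<close>

definition components_are ::
  "'a pair_pre_digraph \<Rightarrow> (('a, 'a \<times> 'a) pre_digraph \<Rightarrow> bool) list \<Rightarrow> bool" where
  "components_are G Ps \<longleftrightarrow>
     (\<exists>Hs. distinct Hs \<and> set Hs = components G \<and> list_all2 (\<lambda>P H. P H) Ps Hs)"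

text \<open>
  Matrix identities between graphs on the same vertex set are meant for one common ordering vs,
  a distinct list enumerating that set.
\<close>

definition adj_mat :: "'a list \<Rightarrow> 'a pair_pre_digraph \<Rightarrow> real mat" where
  "adj_mat vs G = mat (length vs) (length vs)
     (\<lambda>(i, j). if (vs ! i, vs ! j) \<in> parcs G then 1 else 0)"

lemma finite_board [simp]: "finite (board n)"
  by (simp add: board_def)

lemma finite_triangle_verts [simp]: "finite (triangle_verts m)"
proof (rule finite_subset)
  show "triangle_verts m \<subseteq> {1..m} \<times> {1..m}" by (auto simp: triangle_verts_def)
qed simp

lemma pair_graph_queens: "pair_graph (queens n)"
proof
  show "finite (parcs (queens n))"
    by (rule finite_subset[of _ "board n \<times> board n"]) (auto simp: queens_def)
qed (auto simp: queens_def symmetric_def sym_def)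

lemma pair_graph_triangular: "pair_graph (triangular m)"
proof
  show "finite (parcs (triangular m))"
    by (rule finite_subset[of _ "triangle_verts m \<times> triangle_verts m"]) (auto simp: triangular_def)
qed (auto simp: triangular_def symmetric_def sym_def)

end

theory Submission
  imports Defs
begin

text \<open>
  Two distinct squares share at most one of the four kinds of lines (row, column, diagonal,
  antidiagonal), because any two of the four coordinates $r$, $c$, $r-c$, $r+c$ determine the
  square. Moreover $r-c$ is constant on a diagonal parallel to the main one, and its sign is the
  colour; hence such a diagonal is monochromatic, and an edge between a blue and a red square
  that is not antidiagonal lies in a row or in a column. So every edge is of exactly one of these
  kinds: monochromatic and not antidiagonal (\<open>side\<close>), antidiagonal
  (\<open>antidiag_graph\<close>), two-coloured in a row or two-coloured in a column
  (\<open>crossing\<close>). This is \<open>parcs_queens\<close> with the disjointness lemmas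
  after it, and all the matrix identities follow from it, since the adjacency matrix of an
  edge-disjoint union is the sum of the adjacency matrices.

  Each kind is then identified. The blue squares are literally the vertices of the triangular
  graph, with the same three kinds of lines; the red triangle becomes the smaller triangular
  graph by transposing it and moving it one step, which exchanges rows and columns and keeps
  diagonals (\<open>side_blue\<close>, \<open>side_red_iso\<close>). Antidiagonal edges join
  any two squares of an antidiagonal, so they form cliques
  (\<open>components_antidiag_graph\<close>). Row $p<n$ consists of $p$ blue squares followed
  by $n-p$ red ones, and column $p+1$ of $p$ red squares above $n-p$ blue ones; the two-coloured
  edges make each of them a $K_{p,n-p}$, while the last row and the first column are entirely
  blue and contribute the isolated vertices.

  The criterion \<open>components_eqI\<close> yields all the lists of components: a partition of
  a graph into connected pieces without edges between them is its partition into components.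
\<close>

section \<open>Connected components read off from a decomposition\<close>

lemma inj_with_proj: "inj with_proj"
proof (rule injI)
  fix G H :: "'a pair_pre_digraph"
  assume "with_proj G = with_proj H"
  then show "G = H" by (cases G, cases H) (simp add: with_proj_def)
qed

text \<open>
  In a symmetric digraph a walk to a hub can be reversed, so any two vertices are joined
  through the hub.
\<close>

lemma sym_strongly_connectedI_hub:
  assumes "pair_sym_digraph G" "w \<in> pverts G"
    and hub: "\<And>u. u \<in> pverts G \<Longrightarrow> u \<rightarrow>\<^sup>*\<^bsub>with_proj G\<^esub> w"
  shows "strongly_connected (with_proj G)"
proof
  interpret pair_sym_digraph G by fact
  show "verts (with_proj G) \<noteq> {}" using assms(2) by auto
  fix u v assume "u \<in> verts (with_proj G)" "v \<in> verts (with_proj G)"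
  then have "u \<rightarrow>\<^sup>*\<^bsub>with_proj G\<^esub> w" "v \<rightarrow>\<^sup>*\<^bsub>with_proj G\<^esub> w" using hub by auto
  then show "u \<rightarrow>\<^sup>*\<^bsub>with_proj G\<^esub> v"
    using symmetric_reachable' reachable_trans by blast
qed

text \<open>
  A walk cannot leave a piece, because every arc belongs to some piece and the pieces have
  disjoint vertex sets; so each connected piece is a maximal connected set. The pieces cover all
  vertices, hence there are no further components.
\<close>

lemma components_eqI:
  fixes \<C> :: "'a pair_pre_digraph set"
  assumes G: "pair_graph G"
    and verts: "pverts G = (\<Union>C\<in>\<C>. pverts C)"
    and arcs: "parcs G = (\<Union>C\<in>\<C>. parcs C)"
    and within: "\<And>C. C \<in> \<C> \<Longrightarrow> parcs C \<subseteq> pverts C \<times> pverts C"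
    and disj: "\<And>C D. C \<in> \<C> \<Longrightarrow> D \<in> \<C> \<Longrightarrow> C \<noteq> D \<Longrightarrow> pverts C \<inter> pverts D = {}"
    and conn: "\<And>C. C \<in> \<C> \<Longrightarrow> strongly_connected (with_proj C)"
  shows "components G = with_proj ` \<C>"
proof -
  interpret pair_graph G by fact
  have "with_proj C \<in> sccs" if C: "C \<in> \<C>" for C
  proof -
    have arcs_C: "(u, v) \<in> parcs C" if uv: "(u, v) \<in> parcs G" "u \<in> pverts C \<or> v \<in> pverts C" for u v
    proof -
      obtain D where D: "D \<in> \<C>" "(u, v) \<in> parcs D" using uv(1) arcs by auto
      then have "D = C" using within[OF D(1)] disj[OF D(1) C] uv(2) by blast
      then show ?thesis using D by simp
    qed
    have sub: "subgraph (with_proj C) (with_proj G)"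
    proof (rule subgraphI)
      show "wf_digraph (with_proj C)"
        using within[OF C] by unfold_locales auto
      show "wf_digraph (with_proj G)" ..
    qed (use C verts arcs in auto)
    have stay: "v \<in> pverts C" if "u \<rightarrow>\<^sup>*\<^bsub>with_proj G\<^esub> v" "u \<in> pverts C" for u v
      using that
    proof (induct rule: reachable_induct)
      case (step x y)
      then show ?case using arcs_C[of x y] within[OF C] by auto
    qed
    have "u \<rightarrow>\<^sup>*\<^bsub>with_proj G\<^esub> v" if "u \<in> pverts C" "v \<in> pverts C" for u v
      using conn[OF C] that reachable_mono[OF _ sub] by (simp add: strongly_connected_def)
    moreover have "pverts C \<noteq> {}"
      using conn[OF C] by (simp add: strongly_connected_def)
    ultimately have "pverts C \<in> sccs_verts"
      unfolding in_sccs_verts_conv_reachable by (intro conjI ballI allI impI) (auto dest: stay)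
    then have "with_proj G \<restriction> pverts C \<in> sccs" by (rule in_verts_sccsD_sccs)
    moreover have "{e \<in> parcs G. fst e \<in> pverts C \<and> snd e \<in> pverts C} = parcs C"
    proof (intro equalityI subsetI)
      fix e assume "e \<in> {e \<in> parcs G. fst e \<in> pverts C \<and> snd e \<in> pverts C}"
      then show "e \<in> parcs C" using arcs_C[of "fst e" "snd e"] by simp
    next
      fix e assume e: "e \<in> parcs C"
      then have "e \<in> parcs G" using C unfolding arcs by blast
      then show "e \<in> {e \<in> parcs G. fst e \<in> pverts C \<and> snd e \<in> pverts C}"
        using e within[OF C] by auto
    qed
    then have "with_proj G \<restriction> pverts C = with_proj C"
      by (simp add: induce_subgraph_def with_proj_def)
    ultimately show ?thesis by simp
  qed
  then have "with_proj ` \<C> = sccs"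
    by (intro scc_decomp_unique) (auto simp: Union_def verts)
  then show ?thesis by simp
qed

lemma components_areI:
  assumes "components G = with_proj ` set Cs" "distinct Cs"
    and "list_all2 (\<lambda>P C. P (with_proj C)) Ps Cs"
  shows "components_are G Ps"
  unfolding components_are_def
proof (intro exI conjI)
  show "distinct (map with_proj Cs)"
    using assms(2) inj_with_proj by (auto simp: distinct_map intro: inj_on_subset)
qed (use assms in \<open>auto simp: list_all2_map2\<close>)

section \<open>Cliques and complete bipartite graphs\<close>

lemma strongly_connected_clique_on:
  assumes "S \<noteq> {}"
  shows "strongly_connected (with_proj (clique_on S))"
proof -
  obtain w where w: "w \<in> S" using assms by blast
  interpret C: pair_sym_digraph "clique_on S"
    by unfold_locales (auto simp: clique_on_def symmetric_def sym_def)
  show ?thesis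
  proof (rule sym_strongly_connectedI_hub)
    show "pair_sym_digraph (clique_on S)" ..
    show "w \<in> pverts (clique_on S)" using w by (simp add: clique_on_def)
    fix u assume "u \<in> pverts (clique_on S)"
    then have "u = w \<or> (u, w) \<in> parcs (clique_on S)" "u \<in> pverts (clique_on S)"
      using w by (auto simp: clique_on_def)
    then show "u \<rightarrow>\<^sup>*\<^bsub>with_proj (clique_on S)\<^esub> w" by auto
  qed
qed

lemma complete_digraph_clique_on:
  assumes "finite S"
  shows "complete_digraph (card S) (with_proj (clique_on S))"
  using assms by (auto simp: complete_digraph_pair_def clique_on_def)

definition biclique_on :: "'a set \<Rightarrow> 'a set \<Rightarrow> 'a pair_pre_digraph" where
  "biclique_on U V = \<lparr> pverts = U \<union> V, parcs = U \<times> V \<union> V \<times> U \<rparr>"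

lemma strongly_connected_biclique_on:
  assumes "U \<noteq> {}" "V \<noteq> {}"
  shows "strongly_connected (with_proj (biclique_on U V))"
proof -
  obtain u0 v0 where w: "u0 \<in> U" "v0 \<in> V" using assms by blast
  interpret C: pair_sym_digraph "biclique_on U V"
    by unfold_locales (auto simp: biclique_on_def symmetric_def sym_def)
  show ?thesis
  proof (rule sym_strongly_connectedI_hub)
    show "pair_sym_digraph (biclique_on U V)" ..
    show "u0 \<in> pverts (biclique_on U V)" using w by (simp add: biclique_on_def)
    have v0: "(v0, u0) \<in> parcs (biclique_on U V)" using w by (auto simp: biclique_on_def)
    fix u assume "u \<in> pverts (biclique_on U V)"
    then have "(u, u0) \<in> parcs (biclique_on U V) \<or> (u, v0) \<in> parcs (biclique_on U V)"
      using w by (auto simp: biclique_on_def)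
    then show "u \<rightarrow>\<^sup>*\<^bsub>with_proj (biclique_on U V)\<^esub> u0"
      using v0 C.adj_reachable_trans[of u v0 u0] by auto
  qed
qed

lemma complete_bipartite_digraph_biclique_on:
  assumes "finite U" "finite V" "U \<inter> V = {}"
  shows "complete_bipartite_digraph (card U) (card V) (with_proj (biclique_on U V))"
  using assms by (auto simp: complete_bipartite_digraph_pair_def biclique_on_def)

text \<open>
  The common shape of the row and column graphs between the two colours. Indexing the bicliques
  by the size of one side makes the order of the prescribed list immediate. Every biclique has
  two nonempty sides, so it is connected; an isolated vertex is the clique on one vertex.
\<close>

lemma components_are_bicliques_and_isolated:
  fixes U V :: "nat \<Rightarrow> 'a set" and W :: "'a set"
  assumes G: "pair_graph G"
    and verts: "pverts G = (\<Union>p\<in>{1..<n}. U p \<union> V p) \<union> W"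
    and arcs: "parcs G = (\<Union>p\<in>{1..<n}. U p \<times> V p \<union> V p \<times> U p)"
    and card: "\<And>p. p \<in> {1..<n} \<Longrightarrow> card (U p) = p \<and> card (V p) = n - p"
    and UV: "\<And>p. p \<in> {1..<n} \<Longrightarrow> U p \<inter> V p = {}"
    and disj: "\<And>p q. p \<in> {1..<n} \<Longrightarrow> q \<in> {1..<n} \<Longrightarrow> p \<noteq> q \<Longrightarrow> (U p \<union> V p) \<inter> (U q \<union> V q) = {}"
    and W: "card W = n" "\<And>p. p \<in> {1..<n} \<Longrightarrow> (U p \<union> V p) \<inter> W = {}"
  shows "components_are G (map (\<lambda>p. complete_bipartite_digraph p (n - p)) [1..<n] @
    replicate n (complete_digraph 1))"
proof -
  interpret pair_graph G by fact
  have fin: "finite (U p)" "finite (V p)" if "p \<in> {1..<n}" for p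
    using pair_finite_verts that unfolding verts by (auto intro: finite_subset)
  have "finite W" using pair_finite_verts unfolding verts by simp
  then obtain ws where ws: "distinct ws" "set ws = W" using finite_distinct_list by blast
  define B where "B p = biclique_on (U p) (V p)" for p
  define Cs where "Cs = map B [1..<n] @ map (\<lambda>w. clique_on {w}) ws"
  have set_Cs: "set Cs = B ` {1..<n} \<union> (\<lambda>w. clique_on {w}) ` W"
    by (simp add: Cs_def ws)
  have nonempty: "U p \<noteq> {}" "V p \<noteq> {}" if "p \<in> {1..<n}" for p
    using card[OF that] that by auto
  have pB [simp]: "pverts (B p) = U p \<union> V p" "parcs (B p) = U p \<times> V p \<union> V p \<times> U p" for p
    by (simp_all add: B_def biclique_on_def)
  have pK [simp]: "pverts (clique_on {w}) = {w}" "parcs (clique_on {w}) = {}" for w :: 'a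
    by (auto simp: clique_on_def)
  have "components G = with_proj ` set Cs"
  proof (rule components_eqI[OF G])
    fix C assume "C \<in> set Cs"
    then show "strongly_connected (with_proj C)"
      unfolding set_Cs
    proof (elim UnE imageE)
      fix p assume p: "C = B p" "p \<in> {1..<n}"
      show ?thesis
        unfolding p(1) B_def by (rule strongly_connected_biclique_on) (rule nonempty[OF p(2)])+
    next
      fix w assume "C = clique_on {w}"
      then show ?thesis by (simp add: strongly_connected_clique_on)
    qed
  next
    fix C D assume CD: "C \<in> set Cs" "D \<in> set Cs" "C \<noteq> D"
    from CD(1,2) show "pverts C \<inter> pverts D = {}"
      unfolding set_Cs
    proof (elim UnE imageE)
      fix p q assume "C = B p" "p \<in> {1..<n}" "D = B q" "q \<in> {1..<n}"
      then show ?thesis using disj[of p q] CD(3) by auto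
    next
      fix p w assume "C = B p" "p \<in> {1..<n}" "D = clique_on {w}" "w \<in> W"
      then show ?thesis using W(2)[of p] by auto
    next
      fix p w assume "C = clique_on {w}" "w \<in> W" "D = B p" "p \<in> {1..<n}"
      then show ?thesis using W(2)[of p] by auto
    qed (use CD(3) in auto)
  qed (auto simp: set_Cs verts arcs)
  moreover have "distinct Cs"
  proof -
    have "inj_on B {1..<n}"
    proof (rule inj_onI, rule ccontr)
      fix p q assume pq: "p \<in> {1..<n}" "q \<in> {1..<n}" "B p = B q" "p \<noteq> q"
      then have "U p \<union> V p = U q \<union> V q" by (metis pB(1))
      then show False using disj[OF pq(1,2,4)] nonempty[OF pq(1)] by auto
    qed
    moreover have "inj_on (\<lambda>w. clique_on {w}) W"
      by (rule inj_onI) (metis pK(1) singleton_inject)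
    moreover have "B p \<noteq> clique_on {w}" if "p \<in> {1..<n}" "w \<in> W" for p w
      using W(2)[OF that(1)] that(2) by (metis pB(1) pK(1) Int_iff emptyE singletonI)
    ultimately show ?thesis using ws by (auto simp: Cs_def distinct_map)
  qed
  moreover have "list_all2 (\<lambda>P C. P (with_proj C))
      (map (\<lambda>p. complete_bipartite_digraph p (n - p)) [1..<n] @ replicate n (complete_digraph 1)) Cs"
    unfolding Cs_def
  proof (rule list_all2_appendI)
    have "complete_bipartite_digraph p (n - p) (with_proj (B p))" if "p \<in> {1..<n}" for p
      using complete_bipartite_digraph_biclique_on[OF fin[OF that] UV[OF that]] card[OF that]
      by (simp add: B_def)
    then show "list_all2 (\<lambda>P C. P (with_proj C))
        (map (\<lambda>p. complete_bipartite_digraph p (n - p)) [1..<n]) (map B [1..<n])"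
      by (auto simp: list_all2_conv_all_nth)
    have "length ws = n" using ws W(1) distinct_card by metis
    moreover have "complete_digraph 1 (with_proj (clique_on {w}))" for w :: 'a
      using complete_digraph_clique_on[of "{w}"] by simp
    ultimately show "list_all2 (\<lambda>P C. P (with_proj C))
        (replicate n (complete_digraph 1)) (map (\<lambda>w. clique_on {w}) ws)"
      by (auto simp: list_all2_conv_all_nth)
  qed
  ultimately show ?thesis by (rule components_areI)
qed

section \<open>Adjacency matrices and isomorphisms\<close>

lemma adj_mat_disjoint_Un:
  assumes "parcs G = parcs A \<union> parcs B" "parcs A \<inter> parcs B = {}"
  shows "adj_mat vs G = adj_mat vs A + adj_mat vs B"
  by (rule eq_matI) (use assms in \<open>auto simp: adj_mat_def\<close>)

text \<open>
  Arcs of \<^const>\<open>with_proj\<close> graphs are pairs of vertices, so the vertex map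
  determines the arc map.
\<close>

lemma digraph_iso_with_projI:
  assumes "pair_wf_digraph G" "inj_on f (pverts G)"
    and "pverts H = f ` pverts G" "parcs H = map_prod f f ` parcs G"
  shows "digraph_iso (with_proj G) (with_proj H)"
proof -
  interpret pair_wf_digraph G by fact
  define h where "h = \<lparr> iso_verts = f, iso_arcs = map_prod f f, iso_head = snd, iso_tail = fst \<rparr>"
  have "inj_on (map_prod f f) (pverts G \<times> pverts G)"
    by (rule map_prod_inj_on) fact+
  then have "inj_on (map_prod f f) (parcs G)"
    by (rule inj_on_subset) (auto dest: in_arcsD1 in_arcsD2)
  then have "pre_digraph.digraph_isomorphism (with_proj G) h"
    unfolding pre_digraph.digraph_isomorphism_def
    using assms(2) wf_digraph by (auto simp: h_def)
  moreover have "with_proj H = app_iso h (with_proj G)"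
    using assms(3,4) by (simp add: app_iso_def h_def with_proj_def)
  ultimately show ?thesis unfolding digraph_iso_def by blast
qed

lemma strongly_connected_digraph_isoD:
  assumes "digraph_iso G H" "strongly_connected H"
  shows "strongly_connected G"
  using assms strongly_connected_iso[of G] unfolding digraph_iso_def by blast

section \<open>Triangular graphs\<close>

lemma card_triangle_verts: "card (triangle_verts m) = m * (m + 1) div 2"
proof -
  have "triangle_verts m = (SIGMA i:{1..m}. {1..i})" by (auto simp: triangle_verts_def)
  then have "card (triangle_verts m) = \<Sum> {1..m}" by simp
  then show ?thesis using gauss_sum_from_Suc_0[of m, where ?'a = nat] by simp
qed

text \<open>
  The hub is the corner $(m,1)$: move along row $i$ to column 1, then along column 1 to row $m$.
\<close>

lemma strongly_connected_triangular:
  assumes "m \<ge> 1"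
  shows "strongly_connected (with_proj (triangular m))"
proof -
  interpret pair_graph "triangular m" by (rule pair_graph_triangular)
  show ?thesis
  proof (rule sym_strongly_connectedI_hub)
    show "pair_sym_digraph (triangular m)" ..
    show "(m, 1) \<in> pverts (triangular m)"
      using assms by (simp add: triangular_def triangle_verts_def)
    fix u assume u: "u \<in> pverts (triangular m)"
    obtain i j where ij: "u = (i, j)" by fastforce
    have row: "(i, j) \<rightarrow>\<^sup>*\<^bsub>with_proj (triangular m)\<^esub> (i, 1)"
    proof (cases "j = 1")
      case False
      then have "((i, j), (i, 1)) \<in> parcs (triangular m)"
        using u ij by (auto simp: triangular_def triangle_verts_def)
      then show ?thesis by auto
    qed (use u ij in auto)
    have i1: "(i, 1) \<in> pverts (triangular m)"
      using u ij by (auto simp: triangular_def triangle_verts_def)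
    have "(i, 1) \<rightarrow>\<^sup>*\<^bsub>with_proj (triangular m)\<^esub> (m, 1)"
    proof (cases "i = m")
      case False
      then have "((i, 1), (m, 1)) \<in> parcs (triangular m)"
        using i1 by (auto simp: triangular_def triangle_verts_def)
      then show ?thesis by auto
    qed (use i1 in auto)
    with row show "u \<rightarrow>\<^sup>*\<^bsub>with_proj (triangular m)\<^esub> (m, 1)"
      unfolding ij by (rule reachable_trans)
  qed
qed

section \<open>Splitting the edges of the queens' graph\<close>

definition antidiag :: "(nat \<times> nat) \<times> (nat \<times> nat) \<Rightarrow> bool" where
  "antidiag e \<longleftrightarrow> fst (fst e) + snd (fst e) = fst (snd e) + snd (snd e)"

text \<open>
  Excluding the antidiagonal edges, instead of listing the three other kinds, makes the edges
  disjoint from the antidiagonal ones by construction.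
\<close>

definition side :: "nat \<Rightarrow> (nat \<times> nat) set \<Rightarrow> (nat \<times> nat) pair_pre_digraph" where
  "side n S = \<lparr> pverts = S, parcs = {e \<in> parcs (queens n). e \<in> S \<times> S \<and> \<not> antidiag e} \<rparr>"

definition antidiag_graph :: "nat \<Rightarrow> (nat \<times> nat) pair_pre_digraph" where
  "antidiag_graph n = \<lparr> pverts = board n, parcs = {e \<in> parcs (queens n). antidiag e} \<rparr>"

definition crossing ::
  "nat \<Rightarrow> ((nat \<times> nat) \<times> (nat \<times> nat) \<Rightarrow> bool) \<Rightarrow> (nat \<times> nat) pair_pre_digraph" where
  "crossing n P = \<lparr> pverts = board n,
     parcs = {e \<in> parcs (queens n). P e \<and> joins (blue n) (red n) e} \<rparr>"

lemma pair_graph_within_queens: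
  assumes "R \<subseteq> parcs (queens n)" "sym R" "R \<subseteq> S \<times> S" "finite S"
  shows "pair_graph \<lparr> pverts = S, parcs = R \<rparr>"
proof
  show "finite (parcs \<lparr> pverts = S, parcs = R \<rparr>)"
    using assms(3,4) by (simp add: finite_subset)
qed (use assms in \<open>auto simp: queens_def symmetric_def\<close>)

lemma pair_graph_Diff:
  assumes "pair_graph G" "pair_graph H"
  shows "pair_graph \<lparr> pverts = pverts G, parcs = parcs G - parcs H \<rparr>"
proof -
  interpret G: pair_graph G by fact
  interpret H: pair_graph H by fact
  show ?thesis
  proof
    show "symmetric (with_proj \<lparr> pverts = pverts G, parcs = parcs G - parcs H \<rparr>)"
      using G.arcs_symmetric H.arcs_symmetric by (auto simp: symmetric_def sym_def)
  qed (auto dest: G.arc_fst_in_verts G.arc_snd_in_verts G.pair_no_loops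
      intro: G.pair_finite_verts G.pair_finite_arcs)
qed

lemma blue_eq_triangle_verts: "blue n = triangle_verts n"
  by (auto simp: blue_def board_def triangle_verts_def)

lemma blue_Un_red: "blue n \<union> red n = board n"
  and blue_Int_red: "blue n \<inter> red n = {}"
  by (auto simp: blue_def red_def)

lemma finite_blue [simp]: "finite (blue n)" and finite_red [simp]: "finite (red n)"
  using finite_board[of n] blue_Un_red[of n] by (metis finite_Un)+

lemma sym_side: "sym (parcs (side n S))"
  by (auto simp: side_def queens_def antidiag_def sym_def)

lemma pair_graph_side:
  assumes "finite S"
  shows "pair_graph (side n S)"
  using pair_graph_within_queens[OF _ sym_side[of n S] _ assms] by (auto simp: side_def)

lemma pair_graph_antidiag_graph: "pair_graph (antidiag_graph n)"
  unfolding antidiag_graph_def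
  by (rule pair_graph_within_queens) (auto simp: queens_def antidiag_def sym_def)

lemma pair_graph_crossing:
  assumes "\<And>u v. P (u, v) \<longleftrightarrow> P (v, u)"
  shows "pair_graph (crossing n P)"
  unfolding crossing_def
  by (rule pair_graph_within_queens) (use assms in \<open>auto simp: queens_def joins_def sym_def\<close>)

text \<open>
  Because of this, excluding antidiagonal edges from a colour class removes no edge that lies in
  a row, a column or a diagonal of the other direction.
\<close>

lemma not_antidiag_if_other_line:
  fixes r c r' c' :: nat
  assumes "(r, c) \<noteq> (r', c')" "r = r' \<or> c = c' \<or> int r - int c = int r' - int c'"
  shows "r + c \<noteq> r' + c'"
  using assms by auto

lemma in_parcs_side_iff:
  assumes "S \<subseteq> board n"
  shows "((r, c), (r', c')) \<in> parcs (side n S) \<longleftrightarrow>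
    (r, c) \<in> S \<and> (r', c') \<in> S \<and> (r, c) \<noteq> (r', c') \<and>
    (r = r' \<or> c = c' \<or> int r - int c = int r' - int c')"
  using assms not_antidiag_if_other_line[of r c r' c']
  unfolding side_def queens_def antidiag_def by auto

lemma in_parcs_triangular_iff:
  "((i, j), (k, l)) \<in> parcs (triangular m) \<longleftrightarrow>
    (i, j) \<in> triangle_verts m \<and> (k, l) \<in> triangle_verts m \<and> (i, j) \<noteq> (k, l) \<and>
    (i = k \<or> j = l \<or> int i - int j = int k - int l)"
  by (simp add: triangular_def)

lemma blue_subset_board: "blue n \<subseteq> board n" and red_subset_board: "red n \<subseteq> board n"
  by (auto simp: blue_def red_def)

lemma side_blue: "side n (blue n) = triangular n"
proof -
  have "parcs (side n (blue n)) = parcs (triangular n)"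
    using in_parcs_side_iff[OF blue_subset_board, of _ _ _ _ n] in_parcs_triangular_iff[of _ _ _ _ n]
    by (intro Set.set_eqI) (simp add: blue_eq_triangle_verts split_paired_all)
  moreover have "pverts (side n (blue n)) = pverts (triangular n)"
    by (simp add: side_def triangular_def blue_eq_triangle_verts)
  ultimately show ?thesis by simp
qed

lemma in_red_iff_in_triangle_verts:
  "(r, c) \<in> red n \<longleftrightarrow> c \<ge> 1 \<and> (c - 1, r) \<in> triangle_verts (n - 1)"
  by (auto simp: red_def board_def triangle_verts_def)

lemma bij_betw_red: "bij_betw (\<lambda>(r, c). (c - 1, r)) (red n) (triangle_verts (n - 1))"
  by (rule bij_betw_byWitness[where f' = "\<lambda>(i, j). (j, i + 1)"])
    (auto simp: in_red_iff_in_triangle_verts)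

text \<open>
  The isomorphism sends $(r,c)$ to $(c-1,r)$: transposition moves the triangle above the main
  diagonal below it, and the shift by one closes the gap left by the missing diagonal squares.
\<close>

lemma side_red_iso:
  "digraph_iso (with_proj (side n (red n))) (with_proj (triangular (n - 1)))"
proof (rule digraph_iso_with_projI)
  let ?f = "\<lambda>(r, c). (c - 1, r) :: nat \<times> nat"
  show "pair_wf_digraph (side n (red n))"
    using pair_graph_side[of "red n" n]
    by (meson finite_red pair_graph_def pair_digraph_def pair_fin_digraph_def)
  show "inj_on ?f (pverts (side n (red n)))" "pverts (triangular (n - 1)) = ?f ` pverts (side n (red n))"
    using bij_betw_red[of n] by (simp_all add: bij_betw_def side_def triangular_def)
  have shift: "((j, Suc i), (l, Suc k)) \<in> parcs (side n (red n)) \<longleftrightarrow>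
      ((i, j), (k, l)) \<in> parcs (triangular (n - 1))" for i j k l
    unfolding in_parcs_side_iff[OF red_subset_board] in_parcs_triangular_iff
      in_red_iff_in_triangle_verts by auto
  have to: "map_prod ?f ?f e \<in> parcs (triangular (n - 1))" if e: "e \<in> parcs (side n (red n))" for e
  proof -
    obtain r c r' c' where rc: "e = ((r, c), (r', c'))" by (metis surj_pair)
    then have "c \<ge> 1" "c' \<ge> 1"
      using e by (auto simp: in_parcs_side_iff[OF red_subset_board] in_red_iff_in_triangle_verts)
    then show ?thesis using e shift[of r "c - 1" r' "c' - 1"] by (simp add: rc)
  qed
  have onto: "e \<in> map_prod ?f ?f ` parcs (side n (red n))" if e: "e \<in> parcs (triangular (n - 1))" for e
  proof -
    obtain i j k l where ijkl: "e = ((i, j), (k, l))" by (metis surj_pair)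
    then have "e = map_prod ?f ?f ((j, Suc i), (l, Suc k))" by simp
    moreover have "((j, Suc i), (l, Suc k)) \<in> parcs (side n (red n))"
      using e unfolding ijkl shift .
    ultimately show ?thesis by (rule image_eqI)
  qed
  show "parcs (triangular (n - 1)) = map_prod ?f ?f ` parcs (side n (red n))"
    by (rule equalityI[OF subsetI image_subsetI]) (rule onto to; assumption)+
qed

text \<open>
  The one geometric point is that a two-coloured edge never lies on a diagonal parallel to the
  main one: there $r-c$ is constant, but it is nonnegative at blue squares and negative at red
  ones.
\<close>

lemma parcs_queens:
  "parcs (queens n) = (parcs (side n (blue n)) \<union> parcs (side n (red n))) \<union>
    (parcs (antidiag_graph n) \<union> (parcs (crossing n horizontal) \<union> parcs (crossing n vertical)))"
  (is "?Q = ?U")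
proof (rule equalityI; rule subsetI)
  fix e assume e: "e \<in> ?Q"
  obtain r c r' c' where rc: "e = ((r, c), (r', c'))" by (metis surj_pair)
  have on: "(r, c) \<in> board n" "(r', c') \<in> board n"
    using e by (auto simp: rc queens_def)
  have line: "r = r' \<or> c = c' \<or> int r - int c = int r' - int c' \<or> antidiag e"
    using e by (auto simp: rc queens_def antidiag_def)
  show "e \<in> ?U"
  proof (cases "e \<in> blue n \<times> blue n \<or> e \<in> red n \<times> red n \<or> antidiag e")
    case True
    then show ?thesis using e by (auto simp: side_def antidiag_graph_def)
  next
    case False
    then have "joins (blue n) (red n) e"
      using on by (auto simp: rc joins_def blue_def red_def)
    moreover from this have "int r - int c \<noteq> int r' - int c'"
      by (auto simp: rc joins_def blue_def red_def)
    ultimately show ?thesis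
      using e line False by (auto simp: rc crossing_def horizontal_def vertical_def)
  qed
next
  fix e assume "e \<in> ?U"
  then show "e \<in> ?Q" by (auto simp: side_def antidiag_graph_def crossing_def)
qed

lemma side_disjoint_antidiag: "parcs (side n S) \<inter> parcs (antidiag_graph n) = {}"
  by (auto simp: side_def antidiag_graph_def)

lemma side_disjoint_crossing:
  assumes "S = blue n \<or> S = red n"
  shows "parcs (side n S) \<inter> parcs (crossing n P) = {}"
  using assms blue_Int_red[of n] by (auto simp: side_def crossing_def joins_def)

lemma antidiag_disjoint_crossing:
  assumes "\<And>e. P e \<Longrightarrow> horizontal e \<or> vertical e"
  shows "parcs (antidiag_graph n) \<inter> parcs (crossing n P) = {}"
  using assms
  by (fastforce simp: antidiag_graph_def crossing_def antidiag_def horizontal_def vertical_def queens_def)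

lemma horizontal_disjoint_vertical:
  "parcs (crossing n horizontal) \<inter> parcs (crossing n vertical) = {}"
  by (auto simp: crossing_def horizontal_def vertical_def queens_def)

section \<open>Components of the pieces\<close>

text \<open>
  The row of a square on the antidiagonal $r+c=s$ runs from $\max(1,s-n)$ to $\min(n,s-1)$; the
  interval grows until $s=n+1$ and shrinks afterwards.
\<close>

lemma card_antidiagonal:
  assumes "1 \<le> s"
  shows "card (antidiagonal n s) = min (s - 1) (2 * n + 1 - s)"
proof -
  let ?R = "{max 1 (s - n)..min n (s - 1)}"
  have "antidiagonal n s = (\<lambda>r. (r, s - r)) ` ?R"
    using assms by (auto simp: antidiagonal_def board_def image_iff)
  moreover have "inj_on (\<lambda>r. (r, s - r)) ?R" by (rule inj_onI) simp
  ultimately have card: "card (antidiagonal n s) = Suc (min n (s - 1)) - max 1 (s - n)"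
    by (simp add: card_image)
  show ?thesis
  proof (cases "s \<le> n + 1")
    case True
    then have "max 1 (s - n) = 1" "min n (s - 1) = s - 1" "min (s - 1) (2 * n + 1 - s) = s - 1"
      using assms by linarith+
    then show ?thesis using card by simp
  next
    case False
    then have "max 1 (s - n) = s - n" "min n (s - 1) = n" "min (s - 1) (2 * n + 1 - s) = 2 * n + 1 - s"
      by linarith+
    then show ?thesis using card False by simp
  qed
qed

lemma antidiagonal_ne:
  assumes "s \<in> {2..2 * n}"
  shows "antidiagonal n s \<noteq> {}"
  using card_antidiagonal[of s n] assms by auto

lemma components_antidiag_graph:
  "components (antidiag_graph n) = with_proj ` (\<lambda>s. clique_on (antidiagonal n s)) ` {2..2 * n}"
proof (rule components_eqI[OF pair_graph_antidiag_graph])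
  show "pverts (antidiag_graph n) =
      (\<Union>C\<in>(\<lambda>s. clique_on (antidiagonal n s)) ` {2..2 * n}. pverts C)"
    by (auto simp: antidiag_graph_def clique_on_def antidiagonal_def board_def)
  show "parcs (antidiag_graph n) =
      (\<Union>C\<in>(\<lambda>s. clique_on (antidiagonal n s)) ` {2..2 * n}. parcs C)"
    by (auto simp: antidiag_graph_def clique_on_def antidiagonal_def board_def antidiag_def queens_def)
  show "strongly_connected (with_proj C)"
    if "C \<in> (\<lambda>s. clique_on (antidiagonal n s)) ` {2..2 * n}" for C
    using that strongly_connected_clique_on[OF antidiagonal_ne] by auto
qed (auto simp: clique_on_def antidiagonal_def)

lemma nth_up_down:
  assumes "i < 2 * n - 1"
  shows "([1..<n] @ [n] @ rev [1..<n]) ! i = min (i + 1) (2 * n - 1 - i)"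
  using assms by (auto simp: nth_append rev_nth nth_Cons' min_def)

text \<open>
  Listing the antidiagonals by increasing $s=r+c$, starting with $s=2$, puts their sizes into the
  order $1,\dots,n-1,n,n-1,\dots,1$.
\<close>

lemma components_are_antidiag_graph:
  assumes "n \<ge> 1"
  shows "components_are (antidiag_graph n) (map complete_digraph ([1..<n] @ [n] @ rev [1..<n]))"
proof (rule components_areI)
  let ?Cs = "map (\<lambda>s. clique_on (antidiagonal n s)) [2..<2 * n + 1]"
  have "{2..<2 * n + 1} = {2..2 * n}" by auto
  then show "components (antidiag_graph n) = with_proj ` set ?Cs"
    by (simp add: components_antidiag_graph image_image del: upt_Suc)
  have "inj_on (\<lambda>s. clique_on (antidiagonal n s)) {2..<2 * n + 1}"
  proof (rule inj_onI)
    fix s t assume s: "s \<in> {2..<2 * n + 1}"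
      and eq: "clique_on (antidiagonal n s) = clique_on (antidiagonal n t)"
    have "antidiagonal n s = antidiagonal n t" using eq by (simp add: clique_on_def)
    moreover obtain v where "v \<in> antidiagonal n s" using antidiagonal_ne[of s n] s by fastforce
    ultimately show "s = t" by (auto simp: antidiagonal_def)
  qed
  then show "distinct ?Cs" by (simp add: distinct_map del: upt_Suc)
  show "list_all2 (\<lambda>P C. P (with_proj C))
      (map complete_digraph ([1..<n] @ [n] @ rev [1..<n])) ?Cs"
  proof (rule list_all2_all_nthI)
    show len: "length (map complete_digraph ([1..<n] @ [n] @ rev [1..<n])) = length ?Cs"
      using assms by simp
    fix i assume "i < length (map complete_digraph ([1..<n] @ [n] @ rev [1..<n]))"
    then have i: "i < 2 * n - 1" using assms by simp
    have "finite (antidiagonal n (i + 2))"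
      by (rule finite_subset[OF _ finite_board[of n]]) (auto simp: antidiagonal_def)
    then have "complete_digraph (card (antidiagonal n (i + 2)))
        (with_proj (clique_on (antidiagonal n (i + 2))))"
      by (rule complete_digraph_clique_on)
    moreover have "card (antidiagonal n (i + 2)) = ([1..<n] @ [n] @ rev [1..<n]) ! i"
      unfolding nth_up_down[OF i] using card_antidiagonal[of "i + 2" n] i by simp
    moreover have "i < length ([1..<n] @ [n] @ rev [1..<n])" using i assms by simp
    moreover have "?Cs ! i = clique_on (antidiagonal n (i + 2))"
      using i by (simp add: add.commute del: upt_Suc)
    ultimately show "(map complete_digraph ([1..<n] @ [n] @ rev [1..<n]) ! i) (with_proj (?Cs ! i))"
      by (simp only: nth_map)
  qed
qed

lemma in_parcs_crossing_horizontal_iff: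
  "((r, c), (r', c')) \<in> parcs (crossing n horizontal) \<longleftrightarrow>
    r = r' \<and> ((r, c) \<in> blue n \<and> (r', c') \<in> red n \<or> (r, c) \<in> red n \<and> (r', c') \<in> blue n)"
  using blue_subset_board[of n] red_subset_board[of n] blue_Int_red[of n]
  by (auto simp: crossing_def queens_def horizontal_def joins_def)

lemma in_parcs_crossing_vertical_iff:
  "((r, c), (r', c')) \<in> parcs (crossing n vertical) \<longleftrightarrow>
    c = c' \<and> ((r, c) \<in> blue n \<and> (r', c') \<in> red n \<or> (r, c) \<in> red n \<and> (r', c') \<in> blue n)"
  using blue_subset_board[of n] red_subset_board[of n] blue_Int_red[of n]
  by (auto simp: crossing_def queens_def vertical_def joins_def)

lemma in_blue_iff: "(r, c) \<in> blue n \<longleftrightarrow> 1 \<le> c \<and> c \<le> r \<and> r \<le> n"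
  and in_red_iff: "(r, c) \<in> red n \<longleftrightarrow> 1 \<le> r \<and> r < c \<and> c \<le> n"
  by (auto simp: blue_def red_def board_def)

text \<open>
  The last row is entirely blue, so its squares are the isolated vertices.
\<close>

lemma components_are_crossing_horizontal:
  assumes "n \<ge> 1"
  shows "components_are (crossing n horizontal)
    (map (\<lambda>p. complete_bipartite_digraph p (n - p)) [1..<n] @ replicate n (complete_digraph 1))"
proof (rule components_are_bicliques_and_isolated[where
      U = "\<lambda>p. {p} \<times> {1..p}" and V = "\<lambda>p. {p} \<times> {p<..n}" and W = "{n} \<times> {1..n}"])
  show "pair_graph (crossing n horizontal)"
    by (rule pair_graph_crossing) (auto simp: horizontal_def)
  have pick: "(\<exists>p\<in>{1..<n}. r = p \<and> Q p) \<longleftrightarrow> 1 \<le> r \<and> r < n \<and> Q r" for r Q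
    by auto
  show "pverts (crossing n horizontal) =
      (\<Union>p\<in>{1..<n}. {p} \<times> {1..p} \<union> {p} \<times> {p<..n}) \<union> {n} \<times> {1..n}"
  proof (rule Set.set_eqI)
    fix v :: "nat \<times> nat"
    obtain r c where v: "v = (r, c)" by fastforce
    have "v \<in> (\<Union>p\<in>{1..<n}. {p} \<times> {1..p} \<union> {p} \<times> {p<..n}) \<longleftrightarrow>
        (\<exists>p\<in>{1..<n}. r = p \<and> (c \<in> {1..p} \<or> c \<in> {p<..n}))"
      unfolding v by auto
    then show "v \<in> pverts (crossing n horizontal) \<longleftrightarrow>
        v \<in> (\<Union>p\<in>{1..<n}. {p} \<times> {1..p} \<union> {p} \<times> {p<..n}) \<union> {n} \<times> {1..n}"
      unfolding pick using assms by (auto simp: v crossing_def board_def)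
  qed
  show "parcs (crossing n horizontal) =
      (\<Union>p\<in>{1..<n}. ({p} \<times> {1..p}) \<times> ({p} \<times> {p<..n}) \<union> ({p} \<times> {p<..n}) \<times> ({p} \<times> {1..p}))"
  proof (rule Set.set_eqI)
    fix e :: "(nat \<times> nat) \<times> (nat \<times> nat)"
    obtain r c r' c' where e: "e = ((r, c), (r', c'))" by (metis surj_pair)
    have "e \<in> (\<Union>p\<in>{1..<n}. ({p} \<times> {1..p}) \<times> ({p} \<times> {p<..n}) \<union>
        ({p} \<times> {p<..n}) \<times> ({p} \<times> {1..p})) \<longleftrightarrow>
        (\<exists>p\<in>{1..<n}. r = p \<and> r' = p \<and>
          (c \<in> {1..p} \<and> c' \<in> {p<..n} \<or> c \<in> {p<..n} \<and> c' \<in> {1..p}))"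
      unfolding e by auto
    then show "e \<in> parcs (crossing n horizontal) \<longleftrightarrow>
        e \<in> (\<Union>p\<in>{1..<n}. ({p} \<times> {1..p}) \<times> ({p} \<times> {p<..n}) \<union>
          ({p} \<times> {p<..n}) \<times> ({p} \<times> {1..p}))"
      unfolding pick e in_parcs_crossing_horizontal_iff in_blue_iff in_red_iff by auto
  qed
qed (auto simp: card_cartesian_product)

text \<open>
  The index $p$ is that of column $p+1$, which has $p$ red squares above the main diagonal; column
  1 has none.
\<close>

lemma components_are_crossing_vertical:
  assumes "n \<ge> 1"
  shows "components_are (crossing n vertical)
    (map (\<lambda>p. complete_bipartite_digraph p (n - p)) [1..<n] @ replicate n (complete_digraph 1))"
proof (rule components_are_bicliques_and_isolated[where
      U = "\<lambda>p. {1..p} \<times> {p + 1}" and V = "\<lambda>p. {p<..n} \<times> {p + 1}" and W = "{1..n} \<times> {1}"])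
  show "pair_graph (crossing n vertical)"
    by (rule pair_graph_crossing) (auto simp: vertical_def)
  have shift: "(\<exists>p\<in>{1..<n}. c = p + 1 \<and> Q p) \<longleftrightarrow> 2 \<le> c \<and> c \<le> n \<and> Q (c - 1)" for c Q
    by (cases c) auto
  show "pverts (crossing n vertical) =
      (\<Union>p\<in>{1..<n}. {1..p} \<times> {p + 1} \<union> {p<..n} \<times> {p + 1}) \<union> {1..n} \<times> {1}"
  proof (rule Set.set_eqI)
    fix v :: "nat \<times> nat"
    obtain r c where v: "v = (r, c)" by fastforce
    have "v \<in> (\<Union>p\<in>{1..<n}. {1..p} \<times> {p + 1} \<union> {p<..n} \<times> {p + 1}) \<longleftrightarrow>
        (\<exists>p\<in>{1..<n}. c = p + 1 \<and> (r \<in> {1..p} \<or> r \<in> {p<..n}))"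
      unfolding v by auto
    then show "v \<in> pverts (crossing n vertical) \<longleftrightarrow>
        v \<in> (\<Union>p\<in>{1..<n}. {1..p} \<times> {p + 1} \<union> {p<..n} \<times> {p + 1}) \<union> {1..n} \<times> {1}"
      unfolding shift using assms by (auto simp: v crossing_def board_def)
  qed
  show "parcs (crossing n vertical) =
      (\<Union>p\<in>{1..<n}. ({1..p} \<times> {p + 1}) \<times> ({p<..n} \<times> {p + 1}) \<union>
        ({p<..n} \<times> {p + 1}) \<times> ({1..p} \<times> {p + 1}))"
  proof (rule Set.set_eqI)
    fix e :: "(nat \<times> nat) \<times> (nat \<times> nat)"
    obtain r c r' c' where e: "e = ((r, c), (r', c'))" by (metis surj_pair)
    have "e \<in> (\<Union>p\<in>{1..<n}. ({1..p} \<times> {p + 1}) \<times> ({p<..n} \<times> {p + 1}) \<union>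
        ({p<..n} \<times> {p + 1}) \<times> ({1..p} \<times> {p + 1})) \<longleftrightarrow>
        (\<exists>p\<in>{1..<n}. c = p + 1 \<and> c' = p + 1 \<and>
          (r \<in> {1..p} \<and> r' \<in> {p<..n} \<or> r \<in> {p<..n} \<and> r' \<in> {1..p}))"
      unfolding e by auto
    then show "e \<in> parcs (crossing n vertical) \<longleftrightarrow>
        e \<in> (\<Union>p\<in>{1..<n}. ({1..p} \<times> {p + 1}) \<times> ({p<..n} \<times> {p + 1}) \<union>
          ({p<..n} \<times> {p + 1}) \<times> ({1..p} \<times> {p + 1}))"
      unfolding shift e in_parcs_crossing_vertical_iff in_blue_iff in_red_iff by (cases c) auto
  qed
qed (auto simp: card_cartesian_product)

lemma strongly_connected_side_blue:
  assumes "n \<ge> 1"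
  shows "strongly_connected (with_proj (side n (blue n)))"
  unfolding side_blue using assms by (rule strongly_connected_triangular)

lemma strongly_connected_side_red:
  assumes "n \<ge> 2"
  shows "strongly_connected (with_proj (side n (red n)))"
  using assms by (intro strongly_connected_digraph_isoD[OF side_red_iso] strongly_connected_triangular) simp

definition sides :: "nat \<Rightarrow> (nat \<times> nat) pair_pre_digraph" where
  "sides n = \<lparr> pverts = pverts (side n (blue n)) \<union> pverts (side n (red n)),
     parcs = parcs (side n (blue n)) \<union> parcs (side n (red n)) \<rparr>"

lemma pair_graph_sides: "pair_graph (sides n)"
proof -
  have sides: "sides n = \<lparr> pverts = board n, parcs = parcs (sides n) \<rparr>"
    by (simp add: sides_def side_def blue_Un_red)
  have "sym (parcs (sides n))"
    by (simp add: sides_def sym_Un sym_side)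
  moreover have "parcs (sides n) \<subseteq> board n \<times> board n" "parcs (sides n) \<subseteq> parcs (queens n)"
    using blue_subset_board[of n] red_subset_board[of n] by (auto simp: sides_def side_def)
  ultimately show ?thesis
    by (subst sides) (rule pair_graph_within_queens; simp)
qed

lemma components_sides:
  assumes "n \<ge> 2"
  shows "components (sides n) = {with_proj (side n (blue n)), with_proj (side n (red n))}"
    and "card (components (sides n)) = 2"
proof -
  \<comment> \<open>The bound on \<open>n\<close> makes both triangles nonempty.\<close>
  have blue: "strongly_connected (with_proj (side n (blue n)))"
    using assms by (intro strongly_connected_side_blue) simp
  have red: "strongly_connected (with_proj (side n (red n)))"
    by (rule strongly_connected_side_red[OF assms])
  have "components (sides n) = with_proj ` {side n (blue n), side n (red n)}"
  proof (rule components_eqI[OF pair_graph_sides])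
    fix C D assume "C \<in> {side n (blue n), side n (red n)}" "D \<in> {side n (blue n), side n (red n)}" "C \<noteq> D"
    then show "pverts C \<inter> pverts D = {}"
      using blue_Int_red[of n] by (auto simp: side_def)
  qed (use blue red in \<open>auto simp: sides_def side_def\<close>)
  then show *: "components (sides n) = {with_proj (side n (blue n)), with_proj (side n (red n))}"
    by simp
  have "blue n \<noteq> red n"
    using blue blue_Int_red[of n] by (auto simp: strongly_connected_def side_def)
  then have "with_proj (side n (blue n)) \<noteq> with_proj (side n (red n))"
    by (simp add: with_proj_def side_def)
  then show "card (components (sides n)) = 2" unfolding * by simp
qed

theorem theorem4p2:
  fixes n :: nat
  assumes "n \<ge> 4"
  shows "blue n \<union> red n = board n \<and> blue n \<inter> red n = {} \<and>
    card (blue n) = n * (n + 1) div 2 \<and> card (red n) = (n - 1) * n div 2 \<and>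
    (\<exists>E1 E2 G1 G2 G12 G3 G31 G32 G3H G3V.
      E1 \<subseteq> parcs (queens n) \<and> sym E1 \<and> E1 \<subseteq> blue n \<times> blue n \<and>
      E2 \<subseteq> parcs (queens n) \<and> sym E2 \<and> E2 \<subseteq> red n \<times> red n \<and>

      G1 = \<lparr> pverts = blue n, parcs = E1 \<rparr> \<and>
      G2 = \<lparr> pverts = red n, parcs = E2 \<rparr> \<and>
      digraph_iso (with_proj G1) (with_proj (triangular n)) \<and>
      digraph_iso (with_proj G2) (with_proj (triangular (n - 1))) \<and>
      G12 = \<lparr> pverts = pverts G1 \<union> pverts G2, parcs = parcs G1 \<union> parcs G2 \<rparr> \<and>
      components G12 = {with_proj G1, with_proj G2} \<and> card (components G12) = 2 \<and>

      G3 = \<lparr> pverts = board n, parcs = parcs (queens n) - parcs G12 \<rparr> \<and>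
      (\<forall>G \<in> {G1, G2, G12, G3, G31, G32, G3H, G3V}. pair_graph G) \<and>
      (\<forall>G \<in> {G12, G3, G31, G32, G3H, G3V}. pverts G = board n) \<and>
      (\<forall>vs. distinct vs \<and> set vs = board n \<longrightarrow>
        adj_mat vs G3 = adj_mat vs G31 + adj_mat vs G32) \<and>

      components G31 = {with_proj (clique_on (antidiagonal n s)) | s. s \<in> {2..2 * n}} \<and>
      components_are G31 (map complete_digraph ([1..<n] @ [n] @ rev [1..<n])) \<and>

      parcs G32 = parcs G3 - parcs G31 \<and>
      parcs G3H = {e \<in> parcs (queens n). horizontal e \<and> joins (blue n) (red n) e} \<and>
      parcs G3V = {e \<in> parcs (queens n). vertical e \<and> joins (blue n) (red n) e} \<and>
      parcs G32 = parcs G3H \<union> parcs G3V \<and> parcs G3H \<inter> parcs G3V = {} \<and>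
      (\<forall>vs. distinct vs \<and> set vs = board n \<longrightarrow>
        adj_mat vs G32 = adj_mat vs G3H + adj_mat vs G3V) \<and>
      (\<forall>G \<in> {G3H, G3V}. components_are G
        (map (\<lambda>p. complete_bipartite_digraph p (n - p)) [1..<n] @
         replicate n (complete_digraph 1))) \<and>

      (\<forall>vs. distinct vs \<and> set vs = board n \<longrightarrow>
        adj_mat vs (queens n) = adj_mat vs G12 + adj_mat vs G3 \<and>
        adj_mat vs (queens n) =
          adj_mat vs G12 + (adj_mat vs G31 + (adj_mat vs G3H + adj_mat vs G3V))))"
proof -
  have n: "n \<ge> 1" "n \<ge> 2" using assms by simp_all
  let ?G1 = "side n (blue n)" and ?G2 = "side n (red n)" and ?G12 = "sides n"
    and ?G31 = "antidiag_graph n" and ?G3H = "crossing n horizontal" and ?G3V = "crossing n vertical"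
  define G3 where "G3 = \<lparr> pverts = board n, parcs = parcs (queens n) - parcs ?G12 \<rparr>"
  define G32 where "G32 = \<lparr> pverts = board n, parcs = parcs G3 - parcs ?G31 \<rparr>"

  have G12: "parcs ?G12 = parcs ?G1 \<union> parcs ?G2" by (simp add: sides_def)
  have queens: "parcs (queens n) = parcs ?G12 \<union> (parcs ?G31 \<union> (parcs ?G3H \<union> parcs ?G3V))"
    unfolding G12 by (rule parcs_queens)
  have d12: "parcs ?G12 \<inter> (parcs ?G31 \<union> (parcs ?G3H \<union> parcs ?G3V)) = {}"
    unfolding G12 using side_disjoint_antidiag side_disjoint_crossing by blast
  have d31: "parcs ?G31 \<inter> (parcs ?G3H \<union> parcs ?G3V) = {}"
    using antidiag_disjoint_crossing[of horizontal] antidiag_disjoint_crossing[of vertical] by blast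
  have G3: "parcs G3 = parcs ?G31 \<union> (parcs ?G3H \<union> parcs ?G3V)"
    unfolding G3_def using queens d12 by auto
  have G32: "parcs G32 = parcs ?G3H \<union> parcs ?G3V"
    unfolding G32_def using G3 d31 by auto

  have graphs: "pair_graph ?G1" "pair_graph ?G2" "pair_graph ?G12" "pair_graph ?G31"
      "pair_graph ?G3H" "pair_graph ?G3V"
    by (auto intro!: pair_graph_side pair_graph_sides pair_graph_antidiag_graph pair_graph_crossing
        simp: horizontal_def vertical_def)
  have "pair_graph G3"
    using pair_graph_Diff[OF pair_graph_queens[of n] graphs(3)] by (simp add: G3_def queens_def)
  moreover from this have "pair_graph G32"
    using pair_graph_Diff[of G3 ?G31] graphs(4) by (simp add: G32_def G3_def)
  moreover note graphs
  ultimately have all_graphs: "\<forall>G \<in> {?G1, ?G2, ?G12, G3, ?G31, G32, ?G3H, ?G3V}. pair_graph G"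
    by simp

  have split3: "adj_mat vs G3 = adj_mat vs ?G31 + adj_mat vs G32" for vs
    by (rule adj_mat_disjoint_Un) (simp_all add: G3 G32 d31)
  have split32: "adj_mat vs G32 = adj_mat vs ?G3H + adj_mat vs ?G3V" for vs
    by (rule adj_mat_disjoint_Un) (simp_all add: G32 horizontal_disjoint_vertical)
  have split: "adj_mat vs (queens n) = adj_mat vs ?G12 + adj_mat vs G3" for vs
    by (rule adj_mat_disjoint_Un) (simp_all add: queens G3 d12)

  have cards: "card (blue n) = n * (n + 1) div 2" "card (red n) = (n - 1) * n div 2"
    using n bij_betw_same_card[OF bij_betw_red[of n]]
    by (simp_all add: blue_eq_triangle_verts card_triangle_verts)
  have iso: "digraph_iso (with_proj ?G1) (with_proj (triangular n))"
    unfolding side_blue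
    by (rule digraph_iso_with_projI[where f = id])
      (use pair_graph_triangular[of n] in
        \<open>simp_all add: pair_graph_def pair_digraph_def pair_fin_digraph_def map_prod.id\<close>)
  have antidiag: "components ?G31 = {with_proj (clique_on (antidiagonal n s)) | s. s \<in> {2..2 * n}}"
    unfolding components_antidiag_graph by auto
  have verts: "\<forall>G \<in> {?G12, G3, ?G31, G32, ?G3H, ?G3V}. pverts G = board n"
    by (simp add: sides_def side_def blue_Un_red G3_def G32_def antidiag_graph_def crossing_def)
  have crossing: "\<forall>G \<in> {?G3H, ?G3V}. components_are G
      (map (\<lambda>p. complete_bipartite_digraph p (n - p)) [1..<n] @ replicate n (complete_digraph 1))"
    using components_are_crossing_horizontal[OF n(1)] components_are_crossing_vertical[OF n(1)]
    by blast

  show ?thesis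
  proof (intro conjI blue_Un_red blue_Int_red cards,
      rule exI[of _ "parcs ?G1"], rule exI[of _ "parcs ?G2"], rule exI[of _ ?G1],
      rule exI[of _ ?G2], rule exI[of _ ?G12], rule exI[of _ G3], rule exI[of _ ?G31],
      rule exI[of _ G32], rule exI[of _ ?G3H], rule exI[of _ ?G3V],
      intro conjI sym_side iso side_red_iso components_sides[OF n(2)] G3_def all_graphs verts
        antidiag components_are_antidiag_graph[OF n(1)] G32 horizontal_disjoint_vertical crossing
        allI impI split3 split32 split)
    show "parcs ?G1 \<subseteq> parcs (queens n)" "parcs ?G2 \<subseteq> parcs (queens n)"
      "parcs ?G1 \<subseteq> blue n \<times> blue n" "parcs ?G2 \<subseteq> red n \<times> red n"
      "?G1 = \<lparr> pverts = blue n, parcs = parcs ?G1 \<rparr>" "?G2 = \<lparr> pverts = red n, parcs = parcs ?G2 \<rparr>"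
      by (auto simp: side_def)
    show "parcs G32 = parcs G3 - parcs ?G31" by (simp add: G32_def)
    show "adj_mat vs (queens n) =
        adj_mat vs ?G12 + (adj_mat vs ?G31 + (adj_mat vs ?G3H + adj_mat vs ?G3V))" for vs
      by (simp only: split split3 split32)
  qed (simp_all add: sides_def crossing_def)
qed

end
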